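(* Let $K\subset\mathbb{R}^n$ be a star body and let $0\leqslant i\leqslant n-1$. Then, for all $\lambda\in(0,1)$ and any $r>0$, $$\frac{\widetilde{\mathrm{W}}_i\bigl((1-\lambda)K\,\widetilde{+}\,\lambda\,rB_n\bigr)}{\widetilde{\mathrm{W}}_{i+1}\bigl((1-\lambda)K\,\widetilde{+}\,\lambda\,rB_n\bigr)}\leqslant(1-\lambda)\,\frac{\widetilde{\mathrm{W}}_i(K)}{\widetilde{\mathrm{W}}_{i+1}(K)}+\lambda\,\frac{\widetilde{\mathrm{W}}_i(rB_n)}{\widetilde{\mathrm{W}}_{i+1}(rB_n)}.$$ Equality for $0\leqslant i<n-1$, for some $\lambda\in(0,1)$, holds if and only if $K$ is a Euclidean ball centred at the origin.
   Context: A star body is a nonempty compact set $K\subset\mathbb{R}^n$ with $[0,x]\subset K$ for all $x\in K$, whose radial function $\rho_K(u)=\sup\{\lambda\geqslant0:\lambda u\in K\}$, $u\in\mathbb{S}^{n-1}$, is positive and continuous. $B_n$ is the closed Euclidean unit ball. The radial sum is $K\,\widetilde{+}\,E=\{x\,\widetilde{+}\,y:x\in K,\,y\in E\}$, where $x\,\widetilde{+}\,y=x+y$ if $x,y$ lie on a common line through the origin and $x\,\widetilde{+}\,y=0$ otherwise; thus $\rho_{K\widetilde{+}E}=\rho_K+\rho_E$. The dual quermassintegrals $\widetilde{\mathrm{W}}_k(K)$, $0\leqslant k\leqslant n$, are defined by $\mathrm{vol}(K\,\widetilde{+}\,\mu B_n)=\sum_{k=0}^n\binom nk\widetilde{\mathrm{W}}_k(K)\mu^k$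 for $\mu\geqslant0$; equivalently $\widetilde{\mathrm{W}}_k(K)=\frac1n\int_{\mathbb{S}^{n-1}}\rho_K(u)^{n-k}\,du$, with $du$ the spherical Lebesgue measure. *)

theory Defs
  imports "HOL-Analysis.Analysis"
begin

definition radial_function :: "'a::euclidean_space set \<Rightarrow> 'a \<Rightarrow> real" where
  "radial_function K u = Sup {t. t \<ge> 0 \<and> t *\<^sub>R u \<in> K}"

definition star_body :: "'a::euclidean_space set \<Rightarrow> bool" where
  "star_body K \<longleftrightarrow>
     K \<noteq> {} \<and> compact K \<and> (\<forall>x\<in>K. closed_segment 0 x \<subseteq> K) \<and>
     continuous_on (sphere 0 1) (radial_function K) \<and>
     (\<forall>u\<in>sphere 0 1. radial_function K u > 0)"

(* collinear {0, x, y} says that x and y lie on a common line through the origin;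
   this includes the degenerate cases x = 0 and y = 0 *)
definition radial_add :: "'a::euclidean_space \<Rightarrow> 'a \<Rightarrow> 'a" where
  "radial_add x y = (if collinear {0, x, y} then x + y else 0)"

definition radial_sum :: "'a::euclidean_space set \<Rightarrow> 'a set \<Rightarrow> 'a set" where
  "radial_sum K E = {radial_add x y | x y. x \<in> K \<and> y \<in> E}"

(* The dual quermassintegrals are the normalised coefficients of the dual Steiner
   polynomial. The clause on k > DIM('a) only fixes the values outside the
   meaningful index range, so that the coefficient sequence is unique.
   For a star body K such a sequence exists, namely (1/n) times the integral of
   the (n - k)-th power of the radial function over the unit sphere. *)
definition dual_quermass :: "nat \<Rightarrow> 'a::euclidean_space set \<Rightarrow> real" where
  "dual_quermass k K =
     (THE W :: nat \<Rightarrow> real.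
        (\<forall>\<mu>\<ge>0. measure lebesgue (radial_sum K ((*\<^sub>R) \<mu> ` cball 0 1)) =
               (\<Sum>j=0..DIM('a). real (DIM('a) choose j) * W j * \<mu> ^ j)) \<and>
        (\<forall>j>DIM('a). W j = 0)) k"

end

theory Submission imports Defs begin

text \<open>Every spherical integral is expressed over the solid unit ball: for \<open>f\<close> on the sphere, the
  integral of \<open>x \<mapsto> f (x / norm x)\<close> over the unit ball is \<open>1/n\<close> times the integral of \<open>f\<close> over the
  sphere. With \<open>f = (1 - t) \<rho>\<^sub>K\<close>, \<open>\<nu> = t r\<close> and \<open>k = n - i - 1\<close>, the claim becomes
  \<open>\<integral>(f + \<nu>)\<^sup>k\<^sup>+\<^sup>1 / \<integral>(f + \<nu>)\<^sup>k \<le> \<integral>f\<^sup>k\<^sup>+\<^sup>1 / \<integral>f\<^sup>k + \<nu>\<close>. That is, the mean of \<open>f\<close> with weight \<open>(f + \<nu>)\<^sup>k\<close> is at most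
  the mean with weight \<open>f\<^sup>k\<close>, which is Chebyshev's inequality, since the quotient \<open>(f / (f + \<nu>))\<^sup>k\<close> of
  the weights increases with \<open>f\<close>; for \<open>k > 0\<close> equality forces \<open>f\<close> to be constant.\<close>

section \<open>Lebesgue measure on the unit ball\<close>

abbreviation unit_ball_measure :: "'a::euclidean_space measure" where
  "unit_ball_measure \<equiv> restrict_space lborel (cball 0 1)"

lemma finite_measure_unit_ball: "finite_measure (unit_ball_measure :: 'a::euclidean_space measure)"
  using emeasure_bounded_finite[of "cball (0::'a) 1"]
  by (intro finite_measureI) (auto simp: space_restrict_space emeasure_restrict_space)

lemma emeasure_unit_ball_measure_pos:
  "emeasure unit_ball_measure (space (unit_ball_measure :: 'a::euclidean_space measure)) \<noteq> 0"
proof -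
  have "\<not> negligible (cball (0::'a) 1)"
    using open_not_negligible[of "ball (0::'a) 1"] negligible_subset[of "cball (0::'a) 1" "ball 0 1"]
    by auto
  then show ?thesis
    by (auto simp: negligible_iff_null_sets null_sets_def space_restrict_space emeasure_restrict_space)
qed

lemma borel_measurable_unit_ball:
  "g \<in> borel_measurable borel \<Longrightarrow> g \<in> borel_measurable unit_ball_measure"
  by (simp add: measurable_restrict_space1)

section \<open>Volume of radial regions\<close>

text \<open>For nonnegative \<open>f\<close>, the star-shaped set whose radial function on the
  sphere is \<open>f\<close>. As \<open>sgn 0 = 0\<close>, the value \<open>f 0\<close> only decides
  whether the origin belongs to it.\<close>

definition radial_region :: "('a::euclidean_space \<Rightarrow> real) \<Rightarrow> 'a set" where
  "radial_region f = {x. norm x \<le> f (sgn x)}"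

text \<open>Since \<open>g\<close> is constant on open rays, for \<open>v > 0\<close> the set on the
  left is the dilate by \<open>v\<close> of the part of the unit ball where \<open>g = v\<close>.
  For \<open>v = 0\<close> it contains at most the origin, and both sides vanish.\<close>

lemma measure_homogeneous_level_set:
  fixes g :: "'a::euclidean_space \<Rightarrow> real"
  assumes [measurable]: "g \<in> borel_measurable borel"
    and hom: "\<And>c x. c > 0 \<Longrightarrow> g (c *\<^sub>R x) = g x" and "v \<ge> 0"
  shows "measure lborel {x. norm x \<le> v \<and> g x = v} =
    v ^ DIM('a) * measure unit_ball_measure {x \<in> cball 0 1. g x = v}"
proof (cases "v = 0")
  case True
  have "{x. norm x \<le> v \<and> g x = v} \<subseteq> {0::'a}"
    using True by auto
  then have "emeasure lborel {x. norm x \<le> v \<and> g x = v} \<le> emeasure lborel {0::'a}"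
    by (intro emeasure_mono) auto
  then have "measure lborel {x. norm x \<le> v \<and> g x = v} = 0"
    by (simp add: measure_def)
  then show ?thesis using True by simp
next
  case False
  with \<open>v \<ge> 0\<close> have v: "v > 0" by simp
  have eq: "{x. norm x \<le> v \<and> g x = v} = (\<lambda>x. v *\<^sub>R x + 0) ` {x \<in> cball 0 1. g x = v}"
  proof (intro set_eqI iffI)
    fix x assume "x \<in> {x. norm x \<le> v \<and> g x = v}"
    then have "(1/v) *\<^sub>R x \<in> {x \<in> cball 0 1. g x = v}" "x = v *\<^sub>R ((1/v) *\<^sub>R x) + 0"
      using v hom[of "1/v" x] by (auto simp: divide_simps)
    then show "x \<in> (\<lambda>x. v *\<^sub>R x + 0) ` {x \<in> cball 0 1. g x = v}" by blast
  next
    fix x assume "x \<in> (\<lambda>x. v *\<^sub>R x + 0) ` {x \<in> cball 0 1. g x = v}"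
    then show "x \<in> {x. norm x \<le> v \<and> g x = v}"
      using v by (auto simp: hom)
  qed
  have m1: "{x. norm x \<le> v \<and> g x = v} \<in> sets borel" by measurable
  have m2: "{x \<in> cball 0 1. g x = v} \<in> sets borel" by measurable
  have "measure lborel {x. norm x \<le> v \<and> g x = v} = measure lebesgue {x. norm x \<le> v \<and> g x = v}"
    using m1 by simp
  also have "\<dots> = v ^ DIM('a) * measure lebesgue {x \<in> cball 0 1. g x = v}"
    unfolding eq using measure_lebesgue_affine[of v 0 "{x \<in> cball 0 1. g x = v}"] v by simp
  also have "measure lebesgue {x \<in> cball 0 1. g x = v} = measure unit_ball_measure {x \<in> cball 0 1. g x = v}"
    using m2 by (subst measure_restrict_space) auto
  finally show ?thesis .
qed

text \<open>Splitting by the finitely many values \<open>v\<close> of \<open>g\<close> leaves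
  dilated level sets, and the resulting sum of \<open>v ^ n\<close> times their measures in the unit
  ball is the integral of the simple function \<open>g ^ n\<close>, with \<open>n\<close> the
  dimension.\<close>

lemma measure_radial_simple:
  fixes g :: "'a::euclidean_space \<Rightarrow> real"
  assumes [measurable]: "g \<in> borel_measurable borel" and fin: "finite (range g)"
    and nonneg: "\<And>x. g x \<ge> 0" and hom: "\<And>c x. c > 0 \<Longrightarrow> g (c *\<^sub>R x) = g x"
  shows "measure lborel {x. norm x \<le> g x} = (\<integral>x. g x ^ DIM('a) \<partial>unit_ball_measure)"
proof -
  interpret finite_measure "unit_ball_measure :: 'a measure" by (rule finite_measure_unit_ball)
  let ?L = "\<lambda>v. {x. norm x \<le> v \<and> g x = v}"
  let ?C = "\<lambda>v. {x \<in> cball 0 1. g x = v}"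
  have C: "?C v \<in> sets unit_ball_measure" for v
    by (rule sets_restrict_space_iff[THEN iffD2]) (auto, measurable)
  have "{x. norm x \<le> g x} = (\<Union>v\<in>range g. ?L v)" by auto
  then have "measure lborel {x. norm x \<le> g x} = (\<Sum>v\<in>range g. measure lborel (?L v))"
  proof (simp only:, intro measure_finite_Union fin)
    show "?L ` range g \<subseteq> sets lborel" by (auto, measurable)
    show "disjoint_family_on ?L (range g)" by (auto simp: disjoint_family_on_def)
    show "emeasure lborel (?L v) \<noteq> \<infinity>" for v
    proof -
      have "bounded (?L v)" by (rule bounded_subset[of "cball 0 v"]) auto
      then show ?thesis using emeasure_bounded_finite[of "?L v"] by auto
    qed
  qed
  also have "\<dots> = (\<Sum>v\<in>range g. v ^ DIM('a) * measure unit_ball_measure (?C v))"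
    using nonneg by (intro sum.cong refl measure_homogeneous_level_set) (auto simp: hom)
  also have "\<dots> = (\<Sum>v\<in>range g. \<integral>x. v ^ DIM('a) * indicator (?C v) x \<partial>unit_ball_measure)"
  proof (intro sum.cong refl)
    fix v
    have "?C v \<inter> space unit_ball_measure = ?C v" by (auto simp: space_restrict_space)
    then show "v ^ DIM('a) * measure unit_ball_measure (?C v) =
        (\<integral>x. v ^ DIM('a) * indicator (?C v) x \<partial>unit_ball_measure)" by simp
  qed
  also have "\<dots> = (\<integral>x. (\<Sum>v\<in>range g. v ^ DIM('a) * indicator (?C v) x) \<partial>unit_ball_measure)"
    using C by (intro Bochner_Integration.integral_sum[symmetric] integrable_mult_right integrable_real_indicator)
      (auto simp: less_top[symmetric] emeasure_finite)
  also have "\<dots> = (\<integral>x. g x ^ DIM('a) \<partial>unit_ball_measure)"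
  proof (intro Bochner_Integration.integral_cong refl)
    fix x :: 'a assume "x \<in> space unit_ball_measure"
    then have "(\<Sum>v\<in>range g. v ^ DIM('a) * indicator (?C v) x) = (\<Sum>v\<in>range g. if g x = v then v ^ DIM('a) else 0)"
      by (intro sum.cong refl) (auto simp: space_restrict_space indicator_def)
    then show "(\<Sum>v\<in>range g. v ^ DIM('a) * indicator (?C v) x) = g x ^ DIM('a)"
      using fin by simp
  qed
  finally show ?thesis .
qed

text \<open>Stands in for integration in polar coordinates: \<open>g\<close> is squeezed between \<open>s\<close> and \<open>s + d\<close>
  for a homogeneous step function \<open>s\<close> with steps of height \<open>d\<close>.\<close>

lemma measure_radial_homogeneous:
  fixes g :: "'a::euclidean_space \<Rightarrow> real"
  assumes [measurable]: "g \<in> borel_measurable borel"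
    and nonneg: "\<And>x. g x \<ge> 0" and bound: "\<And>x. g x \<le> b"
    and hom: "\<And>c x. c > 0 \<Longrightarrow> g (c *\<^sub>R x) = g x"
  shows "measure lborel {x. norm x \<le> g x} = (\<integral>x. g x ^ DIM('a) \<partial>unit_ball_measure)"
proof -
  interpret finite_measure "unit_ball_measure :: 'a measure" by (rule finite_measure_unit_ball)
  define d where "d m = 1 / real (Suc m)" for m
  define s where "s m x = d m * of_int \<lfloor>g x / d m\<rfloor>" for m x
  have d0: "d m > 0" and d1: "d m \<le> 1" for m by (auto simp: d_def)
  have dlim: "d \<longlonglongrightarrow> 0" unfolding d_def using LIMSEQ_inverse_real_of_nat by (simp add: inverse_eq_divide)
  have [measurable]: "s m \<in> borel_measurable borel" for m unfolding s_def by measurable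
  have s0: "s m x \<ge> 0" for m x using d0[of m] nonneg[of x] by (auto simp: s_def)
  have sle: "s m x \<le> g x" for m x
  proof -
    have "d m * of_int \<lfloor>g x / d m\<rfloor> \<le> d m * (g x / d m)" using d0[of m] by (intro mult_left_mono) auto
    then show ?thesis using d0[of m] by (simp add: s_def)
  qed
  have sge: "g x \<le> s m x + d m" for m x
  proof -
    have "d m * (g x / d m) \<le> d m * (of_int \<lfloor>g x / d m\<rfloor> + 1)" using d0[of m] by (intro mult_left_mono) linarith+
    then show ?thesis using d0[of m] by (simp add: s_def algebra_simps)
  qed
  have fin: "finite (range (s m))" for m
  proof -
    have "range (s m) \<subseteq> (\<lambda>k. d m * of_int k) ` {0..\<lfloor>b / d m\<rfloor>}"
      using d0[of m] nonneg bound
      by (auto simp: s_def intro!: imageI floor_mono divide_right_mono)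
    then show ?thesis by (rule finite_subset) simp
  qed
  have shom: "s m (c *\<^sub>R x) = s m x" if "c > 0" for m c x using hom[OF that] by (simp add: s_def)
  have slim: "(\<lambda>m. s m x) \<longlonglongrightarrow> g x" for x
  proof (rule tendsto_sandwich[of "\<lambda>m. g x - d m" _ _ "\<lambda>m. g x"])
    show "(\<lambda>m. g x - d m) \<longlonglongrightarrow> g x" using tendsto_diff[OF tendsto_const dlim, of "g x"] by simp
    show "\<forall>\<^sub>F m in sequentially. g x - d m \<le> s m x"
      using sge[of x] by (auto intro!: always_eventually simp: algebra_simps)
  qed (use sle in \<open>auto intro!: always_eventually\<close>)
  \<comment> \<open>The bound \<open>b + 1\<close> covers both \<open>g\<close> and the upper
    approximations \<open>s m x + d m\<close>, since \<open>d m \<le> 1\<close>.\<close>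
  have fin_vol: "{x. norm x \<le> h x} \<in> fmeasurable lborel"
    if [measurable]: "h \<in> borel_measurable borel" and "\<And>x. h x \<le> b + 1" for h :: "'a \<Rightarrow> real"
  proof (rule fmeasurableI)
    show "{x. norm x \<le> h x} \<in> sets lborel" by measurable
    have "bounded {x. norm x \<le> h x}"
      by (rule bounded_subset[of "cball 0 (b + 1)"]) (use that in \<open>auto intro: order_trans[OF _ that(2)]\<close>)
    then show "emeasure lborel {x. norm x \<le> h x} < \<infinity>" using emeasure_bounded_finite by auto
  qed
  have sb0: "s m x \<le> b" for m x using sle bound by (rule order_trans)
  have sb: "s m x + d m \<le> b + 1" for m x using sle[of m x] bound[of x] d1[of m] by linarith
  show ?thesis
  proof (rule antisym)
    \<comment> \<open>The regions of the lower approximations lie inside the given one; dominated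
      convergence passes to the limit.\<close>
    have "(\<lambda>m. \<integral>x. s m x ^ DIM('a) \<partial>unit_ball_measure) \<longlonglongrightarrow> (\<integral>x. g x ^ DIM('a) \<partial>unit_ball_measure)"
      by (rule integral_dominated_convergence[where w="\<lambda>_. b ^ DIM('a)"])
         (use s0 sb0 slim in \<open>auto intro!: borel_measurable_unit_ball borel_measurable_power tendsto_power power_mono AE_I2\<close>)
    moreover have "(\<integral>x. s m x ^ DIM('a) \<partial>unit_ball_measure) \<le> measure lborel {x. norm x \<le> g x}" for m
    proof -
      have "measure lborel {x. norm x \<le> s m x} \<le> measure lborel {x. norm x \<le> g x}"
      proof (rule measure_mono_fmeasurable)
        show "{x. norm x \<le> g x} \<in> fmeasurable lborel"
          by (rule fin_vol) (auto intro: order_trans[OF bound])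
        show "{x. norm x \<le> s m x} \<subseteq> {x. norm x \<le> g x}" using sle by (auto intro: order_trans)
      qed measurable
      then show ?thesis using measure_radial_simple[of "s m"] fin s0 shom by simp
    qed
    ultimately show "(\<integral>x. g x ^ DIM('a) \<partial>unit_ball_measure) \<le> measure lborel {x. norm x \<le> g x}"
      by (intro LIMSEQ_le_const2) auto
  next
    \<comment> \<open>The upper approximations give the reverse inequality in the same way.\<close>
    have "(\<lambda>m. \<integral>x. (s m x + d m) ^ DIM('a) \<partial>unit_ball_measure) \<longlonglongrightarrow> (\<integral>x. g x ^ DIM('a) \<partial>unit_ball_measure)"
    proof (rule integral_dominated_convergence[where w="\<lambda>_. (b + 1) ^ DIM('a)"])
      show "AE x in unit_ball_measure. (\<lambda>m. (s m x + d m) ^ DIM('a)) \<longlonglongrightarrow> g x ^ DIM('a)"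
        using tendsto_add[OF slim dlim] by (intro AE_I2 tendsto_power) auto
      show "AE x in unit_ball_measure. norm ((s m x + d m) ^ DIM('a)) \<le> (b + 1) ^ DIM('a)" for m
        using s0[of m] sb[of m] less_imp_le[OF d0[of m]]
        by (intro AE_I2) (auto simp: power_abs intro!: power_mono add_nonneg_nonneg)
    qed (auto intro!: borel_measurable_unit_ball)
    moreover have "measure lborel {x. norm x \<le> g x} \<le> (\<integral>x. (s m x + d m) ^ DIM('a) \<partial>unit_ball_measure)" for m
    proof -
      have "measure lborel {x. norm x \<le> g x} \<le> measure lborel {x. norm x \<le> s m x + d m}"
      proof (rule measure_mono_fmeasurable)
        show "{x. norm x \<le> s m x + d m} \<in> fmeasurable lborel"
          by (rule fin_vol) (auto intro: sb)
        show "{x. norm x \<le> g x} \<subseteq> {x. norm x \<le> s m x + d m}" using sge by (auto intro: order_trans)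
      qed measurable
      also have "\<dots> = (\<integral>x. (s m x + d m) ^ DIM('a) \<partial>unit_ball_measure)"
      proof (rule measure_radial_simple)
        have "range (\<lambda>x. s m x + d m) = (\<lambda>v. v + d m) ` range (s m)" by auto
        then show "finite (range (\<lambda>x. s m x + d m))" using fin by simp
      qed (use s0 d0[of m] shom in \<open>auto intro!: add_nonneg_nonneg less_imp_le\<close>)
      finally show ?thesis .
    qed
    ultimately show "measure lborel {x. norm x \<le> g x} \<le> (\<integral>x. g x ^ DIM('a) \<partial>unit_ball_measure)"
      by (intro LIMSEQ_le_const) auto
  qed
qed

lemma continuous_on_comp_sgn:
  fixes f :: "'a::euclidean_space \<Rightarrow> real"
  assumes "continuous_on (sphere 0 1) f"
  shows "continuous_on (- {0}) (\<lambda>x. f (sgn x))"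
proof (rule continuous_on_compose2[OF assms])
  show "continuous_on (- {0}) (sgn :: 'a \<Rightarrow> 'a)"
    unfolding sgn_div_norm by (intro continuous_intros) auto
qed (auto simp: norm_sgn split: if_splits)

text \<open>Continuity can fail only at the origin, and a single exceptional point does not affect
  Borel measurability.\<close>

lemma borel_measurable_comp_sgn:
  fixes f :: "'a::euclidean_space \<Rightarrow> real"
  assumes "continuous_on (sphere 0 1) f"
  shows "(\<lambda>x. f (sgn x)) \<in> borel_measurable borel"
  using continuous_on_comp_sgn[OF assms]
  by (rule borel_measurable_continuous_countable_exceptions[rotated]) simp

lemma bounded_comp_sgn:
  fixes f :: "'a::euclidean_space \<Rightarrow> real"
  assumes "continuous_on (sphere 0 1) f"
  obtains b where "\<And>x. f (sgn x) \<le> b"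
proof -
  have "compact (f ` sphere 0 1)" using assms by (intro compact_continuous_image) auto
  then obtain B where B: "\<And>u. u \<in> sphere 0 1 \<Longrightarrow> norm (f u) \<le> B"
    using compact_imp_bounded bounded_iff by (metis imageI)
  \<comment> \<open>\<open>sgn 0 = 0\<close> lies off the sphere, where compactness gives no
    control, so \<open>f 0\<close> enters the bound separately.\<close>
  have "f (sgn x) \<le> max B (f 0)" for x
  proof (cases "x = 0")
    case False
    then have "sgn x \<in> sphere 0 1" by (simp add: norm_sgn)
    from B[OF this] show ?thesis by auto
  qed auto
  then show ?thesis using that by blast
qed

text \<open>The volume formula in polar coordinates; integrating over the solid ball absorbs the
  factor \<open>1/n\<close> of the spherical integral.\<close>

lemma measure_radial_region:
  fixes f :: "'a::euclidean_space \<Rightarrow> real"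
  assumes f: "continuous_on (sphere 0 1) f" and pos: "\<And>u. f u \<ge> 0"
  shows "measure lebesgue (radial_region f) = (\<integral>x. f (sgn x) ^ DIM('a) \<partial>unit_ball_measure)"
proof -
  note [measurable] = borel_measurable_comp_sgn[OF f]
  obtain b where b: "\<And>x. f (sgn x) \<le> b" using bounded_comp_sgn[OF f] by blast
  have "radial_region f \<in> sets borel" unfolding radial_region_def by measurable
  then have "measure lebesgue (radial_region f) = measure lborel {x. norm x \<le> f (sgn x)}"
    by (simp add: radial_region_def)
  also have "\<dots> = (\<integral>x. f (sgn x) ^ DIM('a) \<partial>unit_ball_measure)"
    by (rule measure_radial_homogeneous[where b=b]) (use pos b in \<open>auto simp: sgn_scaleR\<close>)
  finally show ?thesis .
qed

section \<open>Star bodies, dilates and radial sums as radial regions\<close>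

lemma cball_eq_radial_region: "cball 0 c = radial_region (\<lambda>_. c)"
  by (auto simp: radial_region_def)

lemma scaleR_cball_0:
  assumes "c \<ge> 0" shows "(*\<^sub>R) c ` cball (0::'a::euclidean_space) 1 = cball 0 c"
  using cball_scale[of c "0::'a" 1] assms by (cases "c = 0") (auto simp: image_constant_conv)

lemma scaleR_radial_region:
  assumes c: "c > 0" shows "(*\<^sub>R) c ` radial_region f = radial_region (\<lambda>u. c * f u)"
proof (intro set_eqI iffI)
  fix x assume "x \<in> (*\<^sub>R) c ` radial_region f"
  then show "x \<in> radial_region (\<lambda>u. c * f u)" using c by (auto simp: radial_region_def sgn_scaleR)
next
  fix x assume "x \<in> radial_region (\<lambda>u. c * f u)"
  then have "(1/c) *\<^sub>R x \<in> radial_region f" "x = c *\<^sub>R ((1/c) *\<^sub>R x)"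
    using c by (auto simp: radial_region_def sgn_scaleR divide_simps mult.commute)
  then show "x \<in> (*\<^sub>R) c ` radial_region f" by blast
qed

text \<open>A nonzero radial sum comes from two points on one line, so only lengths along the
  direction of the sum have to be compared. Allowing \<open>g = 0\<close> covers the degenerate ball
  of radius 0 in the Steiner polynomial.\<close>

lemma radial_sum_radial_region:
  fixes f g :: "'a::euclidean_space \<Rightarrow> real"
  assumes f: "\<And>u. f u > 0" and g: "\<And>u. g u \<ge> 0"
  shows "radial_sum (radial_region f) (radial_region g) = radial_region (\<lambda>u. f u + g u)"
proof (intro set_eqI iffI)
  fix z assume "z \<in> radial_sum (radial_region f) (radial_region g)"
  then obtain x y where xy: "x \<in> radial_region f" "y \<in> radial_region g" and z: "z = radial_add x y"
    by (auto simp: radial_sum_def)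
  show "z \<in> radial_region (\<lambda>u. f u + g u)"
  proof (cases "z = 0")
    case True
    then show ?thesis using f[of 0] g[of 0] by (auto simp: radial_region_def)
  next
    case False
    then have zxy: "z = x + y" and col: "collinear {0, x, y}"
      using z by (auto simp: radial_add_def split: if_splits)
    define u where "u = sgn z"
    have u: "norm u = 1" and zu: "z = norm z *\<^sub>R u"
      using False by (auto simp: u_def norm_sgn sgn_div_norm)
    obtain w \<alpha> \<beta> where w: "x = \<alpha> *\<^sub>R w" "y = \<beta> *\<^sub>R w"
      using col unfolding collinear_lemma by (metis scaleR_one scaleR_zero_left)
    have ab: "z = (\<alpha> + \<beta>) *\<^sub>R w" using zxy w by (simp add: scaleR_add_left)
    with False have "\<alpha> + \<beta> \<noteq> 0" by auto
    \<comment> \<open>As the sum is nonzero, the common line of \<open>x\<close> and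
      \<open>y\<close> is the one spanned by its direction \<open>u\<close>.\<close>
    then have "w = (norm z / (\<alpha> + \<beta>)) *\<^sub>R u"
      using zu ab by (metis (no_types, lifting) divide_inverse_commute scaleR_scaleR scaleR_one left_inverse)
    then obtain a b where x: "x = a *\<^sub>R u" and y: "y = b *\<^sub>R u"
      using w by (metis scaleR_scaleR)
    have "norm z *\<^sub>R u = (a + b) *\<^sub>R u" using zu zxy x y by (simp add: scaleR_add_left)
    then have nz: "norm z = a + b" using u by auto
    have su: "sgn u = u" using u by (simp add: sgn_div_norm)
    \<comment> \<open>For \<open>a \<le> 0\<close> the point is the origin or lies on the opposite
      ray, and positivity of \<open>f u\<close> suffices; for \<open>a > 0\<close> membership gives
      the bound.\<close>
    have "a \<le> f u" using xy(1) x u su f[of u]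
      by (cases "a > 0") (auto simp: radial_region_def sgn_scaleR)
    moreover have "b \<le> g u" using xy(2) y u su g[of u]
      by (cases "b > 0") (auto simp: radial_region_def sgn_scaleR)
    ultimately show ?thesis using nz by (simp add: radial_region_def u_def)
  qed
next
  fix z assume "z \<in> radial_region (\<lambda>u. f u + g u)"
  then have z: "norm z \<le> f (sgn z) + g (sgn z)" by (simp add: radial_region_def)
  \<comment> \<open>Splitting \<open>z\<close> in the ratio of the two radial values keeps each part
    within its own region.\<close>
  define p where "p = f (sgn z) / (f (sgn z) + g (sgn z))"
  define q where "q = g (sgn z) / (f (sgn z) + g (sgn z))"
  have pos: "f (sgn z) > 0" "g (sgn z) \<ge> 0" "f (sgn z) + g (sgn z) > 0"
    using f[of "sgn z"] g[of "sgn z"] by auto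
  have pq: "p > 0" "q \<ge> 0" "p + q = 1"
    using pos by (auto simp: p_def q_def add_divide_distrib[symmetric])
  have "p * norm z \<le> f (sgn z)" "q * norm z \<le> g (sgn z)"
    using z pos by (auto simp: p_def q_def divide_simps mult_left_mono)
  \<comment> \<open>For \<open>q = 0\<close> the second part is the origin, whose membership amounts
    to \<open>g 0 \<ge> 0\<close>.\<close>
  then have "p *\<^sub>R z \<in> radial_region f" "q *\<^sub>R z \<in> radial_region g"
    using pq g[of 0] by (cases "q = 0"; auto simp: radial_region_def sgn_scaleR)+
  moreover have "radial_add (p *\<^sub>R z) (q *\<^sub>R z) = z"
  proof -
    have "collinear {0, p *\<^sub>R z, q *\<^sub>R z}"
      unfolding collinear_lemma using pq by (auto intro!: exI[of _ "q / p"])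
    then show ?thesis using pq by (simp add: radial_add_def scaleR_add_left[symmetric])
  qed
  ultimately show "z \<in> radial_sum (radial_region f) (radial_region g)"
    unfolding radial_sum_def by (metis (mono_tags, lifting) mem_Collect_eq)
qed

text \<open>\<open>radial_function K\<close> carries no information off the sphere, so it may be altered there to a
  globally positive function.\<close>

lemma star_body_radial_region:
  fixes K :: "'a::euclidean_space set"
  assumes "star_body K"
  obtains f where "continuous_on (sphere 0 1) f" "\<And>u. f u > 0" "K = radial_region f"
proof -
  from assms have ne: "K \<noteq> {}" and comp: "compact K"
    and star: "\<And>x. x \<in> K \<Longrightarrow> closed_segment 0 x \<subseteq> K"
    and cont: "continuous_on (sphere 0 1) (radial_function K)"
    and pos: "\<And>u. u \<in> sphere 0 1 \<Longrightarrow> radial_function K u > 0"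
    by (auto simp: star_body_def)
  define f where "f u = (if norm u = 1 then radial_function K u else 1)" for u
  have "continuous_on (sphere 0 1) f"
    using cont by (rule continuous_on_eq) (auto simp: f_def)
  moreover have "f u > 0" for u using pos[of u] by (auto simp: f_def)
  moreover have "x \<in> K \<longleftrightarrow> norm x \<le> f (sgn x)" for x
  proof (cases "x = 0")
    case True
    have "0 \<in> K" using ne star by fastforce
    then show ?thesis using True by (simp add: f_def)
  next
    case False
    define u where "u = sgn x"
    have u: "norm u = 1" and xu: "x = norm x *\<^sub>R u"
      using False by (auto simp: u_def norm_sgn sgn_div_norm)
    define T where "T = {t. t \<ge> 0 \<and> t *\<^sub>R u \<in> K}"
    have fu: "f u = Sup T" using u by (simp add: f_def T_def radial_function_def)
    obtain B where B: "\<And>y. y \<in> K \<Longrightarrow> norm y \<le> B"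
      using compact_imp_bounded[OF comp] bounded_iff by metis
    have bdd: "bdd_above T"
      using B u by (intro bdd_aboveI[of _ B]) (force simp: T_def)
    have "0 \<in> K" using ne star by fastforce
    then have neT: "T \<noteq> {}" by (auto simp: T_def)
    \<comment> \<open>Closedness of \<open>K\<close> makes the supremum attained; the segment from
      the origin to \<open>Sup T *\<^sub>R u\<close> then lies in \<open>K\<close>.\<close>
    have "closed ({0..} \<inter> (\<lambda>t. t *\<^sub>R u) -` K)"
      using comp by (intro closed_Int closed_vimage compact_imp_closed continuous_intros) auto
    moreover have "T = {0..} \<inter> (\<lambda>t. t *\<^sub>R u) -` K" by (auto simp: T_def)
    ultimately have SupT: "Sup T \<in> T" using closed_contains_Sup[OF neT bdd] by simp
    show ?thesis
    proof
      assume "x \<in> K"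
      then have "norm x \<in> T" using xu by (auto simp: T_def)
      then show "norm x \<le> f (sgn x)" using cSup_upper[OF _ bdd] fu by (simp add: u_def)
    next
      assume "norm x \<le> f (sgn x)"
      then have le: "norm x \<le> Sup T" using fu by (simp add: u_def)
      with False have S0: "Sup T > 0" by (meson less_le_trans zero_less_norm_iff)
      have "x = (norm x / Sup T) *\<^sub>R (Sup T *\<^sub>R u)" using xu S0 by simp
      moreover have "0 \<le> norm x / Sup T" "norm x / Sup T \<le> 1" using le S0 by auto
      ultimately have "x \<in> closed_segment 0 (Sup T *\<^sub>R u)"
        unfolding closed_segment_def by force
      then show "x \<in> K" using star[of "Sup T *\<^sub>R u"] SupT by (auto simp: T_def)
    qed
  qed
  then have "K = radial_region f" by (auto simp: radial_region_def)
  ultimately show ?thesis using that by blast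
qed

section \<open>Dual quermassintegrals as moments of the radial function\<close>

lemma integrable_comp_sgn_power:
  fixes f :: "'a::euclidean_space \<Rightarrow> real"
  assumes f: "continuous_on (sphere 0 1) f" and pos: "\<And>u. f u > 0"
  shows "integrable unit_ball_measure (\<lambda>x. f (sgn x) ^ k)"
proof -
  interpret finite_measure "unit_ball_measure :: 'a measure" by (rule finite_measure_unit_ball)
  obtain b where b: "\<And>x. f (sgn x) \<le> b" using bounded_comp_sgn[OF f] by blast
  show ?thesis
  proof (rule integrable_const_bound[where B="b ^ k"])
    show "AE x in unit_ball_measure. norm (f (sgn x) ^ k) \<le> b ^ k"
      using b less_imp_le[OF pos] by (auto simp: power_abs intro!: AE_I2 power_mono)
    show "(\<lambda>x. f (sgn x) ^ k) \<in> borel_measurable unit_ball_measure"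
      by (intro borel_measurable_power borel_measurable_unit_ball borel_measurable_comp_sgn f)
  qed
qed

text \<open>The difference polynomial has infinitely many roots already on the half-line, which is
  where the Steiner polynomial is prescribed.\<close>

lemma polyfun_eq_coeffs_nonneg:
  fixes c d :: "nat \<Rightarrow> real"
  assumes "\<And>x. x \<ge> 0 \<Longrightarrow> (\<Sum>i\<le>n. c i * x ^ i) = (\<Sum>i\<le>n. d i * x ^ i)" and "i \<le> n"
  shows "c i = d i"
proof (rule ccontr)
  assume "c i \<noteq> d i"
  then have "finite {x. (\<Sum>i\<le>n. (c i - d i) * x ^ i) = 0}"
    using polyfun_finite_roots[of "\<lambda>i. c i - d i" n] \<open>i \<le> n\<close> by auto
  moreover have "{0..} \<subseteq> {x. (\<Sum>i\<le>n. (c i - d i) * x ^ i) = 0}"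
    using assms(1) by (auto simp: left_diff_distrib sum_subtractf)
  ultimately have "finite {0::real..}" by (rule finite_subset[rotated])
  then show False using infinite_Ici by blast
qed

text \<open>Adding the ball of radius \<open>\<mu>\<close> adds \<open>\<mu>\<close> to the radial
  function, so expanding the polar volume formula binomially yields the dual Steiner polynomial.
  Uniqueness of its coefficients then evaluates the \<open>THE\<close>.\<close>

lemma dual_quermass_radial_region:
  fixes f :: "'a::euclidean_space \<Rightarrow> real"
  assumes f: "continuous_on (sphere 0 1) f" and pos: "\<And>u. f u > 0" and k: "k \<le> DIM('a)"
  shows "dual_quermass k (radial_region f) = (\<integral>x. f (sgn x) ^ (DIM('a) - k) \<partial>unit_ball_measure)"
proof -
  let ?n = "DIM('a)"
  define W where "W j = (if j \<le> ?n then \<integral>x. f (sgn x) ^ (?n - j) \<partial>unit_ball_measure else 0)" for j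
  have steiner: "measure lebesgue (radial_sum (radial_region f) ((*\<^sub>R) \<mu> ` cball 0 1)) =
      (\<Sum>j=0..?n. real (?n choose j) * W j * \<mu> ^ j)" if "\<mu> \<ge> 0" for \<mu>
  proof -
    have "radial_sum (radial_region f) ((*\<^sub>R) \<mu> ` cball 0 1) = radial_region (\<lambda>u. f u + \<mu>)"
      using radial_sum_radial_region[of f "\<lambda>_. \<mu>"] pos that
      by (simp add: scaleR_cball_0 flip: cball_eq_radial_region)
    then have "measure lebesgue (radial_sum (radial_region f) ((*\<^sub>R) \<mu> ` cball 0 1)) =
        (\<integral>x. (\<mu> + f (sgn x)) ^ ?n \<partial>unit_ball_measure)"
      using measure_radial_region[of "\<lambda>u. f u + \<mu>"] f less_imp_le[OF pos] that
      by (simp add: continuous_intros add.commute)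
    also have "\<dots> = (\<integral>x. (\<Sum>j\<le>?n. real (?n choose j) * \<mu> ^ j * f (sgn x) ^ (?n - j)) \<partial>unit_ball_measure)"
      by (simp add: binomial_ring)
    also have "\<dots> = (\<Sum>j\<le>?n. real (?n choose j) * \<mu> ^ j * (\<integral>x. f (sgn x) ^ (?n - j) \<partial>unit_ball_measure))"
      by (subst Bochner_Integration.integral_sum)
         (auto intro!: integrable_mult_right integrable_comp_sgn_power f pos)
    finally show ?thesis by (simp add: W_def atLeast0AtMost mult_ac)
  qed
  have "(THE W :: nat \<Rightarrow> real.
        (\<forall>\<mu>\<ge>0. measure lebesgue (radial_sum (radial_region f) ((*\<^sub>R) \<mu> ` cball 0 1)) =
               (\<Sum>j=0..?n. real (?n choose j) * W j * \<mu> ^ j)) \<and>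
        (\<forall>j>?n. W j = 0)) = W"
  proof (rule the_equality)
    show "(\<forall>\<mu>\<ge>0. measure lebesgue (radial_sum (radial_region f) ((*\<^sub>R) \<mu> ` cball 0 1)) =
               (\<Sum>j=0..?n. real (?n choose j) * W j * \<mu> ^ j)) \<and> (\<forall>j>?n. W j = 0)"
      using steiner by (auto simp: W_def)
  next
    fix V assume V: "(\<forall>\<mu>\<ge>0. measure lebesgue (radial_sum (radial_region f) ((*\<^sub>R) \<mu> ` cball 0 1)) =
               (\<Sum>j=0..?n. real (?n choose j) * V j * \<mu> ^ j)) \<and> (\<forall>j>?n. V j = 0)"
    show "V = W"
    proof
      fix j
      show "V j = W j"
      proof (cases "j \<le> ?n")
        case True
        \<comment> \<open>Comparison of coefficients includes the binomial factor, which is nonzero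
          for \<open>j \<le> ?n\<close> and cancels.\<close>
        have "real (?n choose j) * V j = real (?n choose j) * W j"
        proof (rule polyfun_eq_coeffs_nonneg[OF _ True])
          fix x :: real assume "x \<ge> 0"
          then show "(\<Sum>i\<le>?n. real (?n choose i) * V i * x ^ i) = (\<Sum>i\<le>?n. real (?n choose i) * W i * x ^ i)"
            using V steiner[of x] by (simp add: atLeast0AtMost)
        qed
        then show ?thesis using True by simp
      next
        case False
        then show ?thesis using V by (simp add: W_def)
      qed
    qed
  qed
  then show ?thesis using k by (simp add: dual_quermass_def W_def)
qed

section \<open>Moment ratios under a shift\<close>

text \<open>Here \<open>a\<close> will be the mean of \<open>f\<close> with weight \<open>(f + \<nu>)\<^sup>k\<close>, so that integrating the inequality at
  \<open>x = f\<close> removes the term carrying the constant \<open>(a / (a + \<nu>))\<^sup>k\<close>.\<close>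

lemma shifted_power_product_nonneg:
  fixes x a \<nu> :: real
  assumes "x \<ge> 0" "a \<ge> 0" "\<nu> > 0"
  shows "(x - a) * (x ^ k - (a / (a + \<nu>)) ^ k * (x + \<nu>) ^ k) \<ge> 0"
    and "k > 0 \<Longrightarrow> (x - a) * (x ^ k - (a / (a + \<nu>)) ^ k * (x + \<nu>) ^ k) = 0 \<Longrightarrow> x = a"
proof -
  \<comment> \<open>This \<open>y\<close> makes the subtracted term a pure \<open>k\<close>-th
    power, and \<open>x - y = \<nu> * (x - a) / (a + \<nu>)\<close> has the sign of
    \<open>x - a\<close>. Hence the two factors of the product never have opposite signs.\<close>
  define y where "y = a * (x + \<nu>) / (a + \<nu>)"
  have y: "(a / (a + \<nu>)) ^ k * (x + \<nu>) ^ k = y ^ k"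
    by (simp add: y_def power_mult_distrib[symmetric])
  have "x - y = \<nu> * (x - a) / (a + \<nu>)"
    using assms by (simp add: y_def field_simps)
  moreover have "a + \<nu> > 0" using assms by simp
  ultimately have "x - y \<ge> 0 \<longleftrightarrow> x - a \<ge> 0" "x - y = 0 \<longleftrightarrow> x - a = 0"
    using assms by (simp_all add: zero_le_divide_iff zero_le_mult_iff)
  then have sg: "x \<ge> y \<longleftrightarrow> x \<ge> a" "x = y \<longleftrightarrow> x = a" by auto
  have y0: "y \<ge> 0" using assms by (simp add: y_def)
  show "(x - a) * (x ^ k - (a / (a + \<nu>)) ^ k * (x + \<nu>) ^ k) \<ge> 0"
    unfolding y
  proof (cases "x \<ge> a")
    case True
    then have "y ^ k \<le> x ^ k" using sg y0 by (intro power_mono) auto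
    then show "(x - a) * (x ^ k - y ^ k) \<ge> 0" using True by simp
  next
    case False
    then have "x ^ k \<le> y ^ k" using sg assms by (intro power_mono) auto
    then show "(x - a) * (x ^ k - y ^ k) \<ge> 0" using False by (simp add: mult_nonpos_nonpos)
  qed
  show "x = a" if "k > 0" "(x - a) * (x ^ k - (a / (a + \<nu>)) ^ k * (x + \<nu>) ^ k) = 0"
    using that sg y0 assms power_eq_imp_eq_base[of x k y] unfolding y by auto
qed

text \<open>Integrating the nonnegative \<open>D\<close> gives
  \<open>a * H k \<le> H (Suc k)\<close>, which is the inequality rewritten. Equality makes the
  integral of \<open>D\<close> zero, so \<open>D\<close> vanishes almost everywhere and, for
  \<open>k > 0\<close>, \<open>f = a\<close> there.\<close>

lemma (in finite_measure) moment_ratio_shift: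
  fixes f :: "'a \<Rightarrow> real"
  assumes [measurable]: "f \<in> borel_measurable M" and pos: "\<And>x. f x > 0" and bound: "\<And>x. f x \<le> b"
    and \<nu>: "\<nu> > 0" and ne: "emeasure M (space M) \<noteq> 0"
  shows "(\<integral>x. (f x + \<nu>) ^ Suc k \<partial>M) / (\<integral>x. (f x + \<nu>) ^ k \<partial>M)
      \<le> (\<integral>x. f x ^ Suc k \<partial>M) / (\<integral>x. f x ^ k \<partial>M) + \<nu>" (is ?ineq)
    and "k > 0 \<Longrightarrow> (\<integral>x. (f x + \<nu>) ^ Suc k \<partial>M) / (\<integral>x. (f x + \<nu>) ^ k \<partial>M)
      = (\<integral>x. f x ^ Suc k \<partial>M) / (\<integral>x. f x ^ k \<partial>M) + \<nu> \<Longrightarrow> \<exists>a. AE x in M. f x = a"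
proof -
  have int: "integrable M (\<lambda>x. (f x + c) ^ j)" if "c \<ge> 0" for c j
  proof (rule integrable_const_bound[where B="(b + c) ^ j"])
    have "\<bar>f x + c\<bar> \<le> b + c" for x using pos[of x] bound[of x] that by linarith
    then show "AE x in M. norm ((f x + c) ^ j) \<le> (b + c) ^ j"
      by (auto simp: power_abs intro!: AE_I2 power_mono)
  qed measurable
  have int0: "integrable M (\<lambda>x. f x ^ j)" for j using int[of 0 j] by simp
  have int\<nu>: "integrable M (\<lambda>x. (f x + \<nu>) ^ j)" for j using int[of \<nu> j] \<nu> by simp
  define G where "G j = (\<integral>x. (f x + \<nu>) ^ j \<partial>M)" for j
  define H where "H j = (\<integral>x. f x ^ j \<partial>M)" for j
  have intpos: "(\<integral>x. h x \<partial>M) > 0" if "integrable M h" "\<And>x. h x > 0" for h :: "'a \<Rightarrow> real"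
    using integral_less_AE_space[of "\<lambda>_. 0" h] that ne by simp
  have G0: "G j > 0" for j unfolding G_def
    by (intro intpos int\<nu> zero_less_power add_pos_pos pos \<nu>)
  have H0: "H j > 0" for j unfolding H_def
    by (intro intpos int0 zero_less_power pos)
  \<comment> \<open>Because \<open>f * (f + \<nu>) ^ k = (f + \<nu>) ^ Suc k - \<nu> * (f + \<nu>) ^
    k\<close>, this is the weighted mean of \<open>f\<close>.\<close>
  define a where "a = G (Suc k) / G k - \<nu>"
  have "\<nu> * G k \<le> G (Suc k)"
  proof -
    have "(\<integral>x. \<nu> * (f x + \<nu>) ^ k \<partial>M) \<le> (\<integral>x. (f x + \<nu>) ^ Suc k \<partial>M)"
      using less_imp_le[OF pos] \<nu>
      by (intro integral_mono integrable_mult_right int\<nu>) (auto intro!: mult_right_mono zero_le_power add_nonneg_nonneg)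
    then show ?thesis by (simp add: G_def)
  qed
  then have a0: "a \<ge> 0" using G0[of k] by (simp add: a_def field_simps)
  define c where "c = (a / (a + \<nu>)) ^ k"
  define D where "D x = (f x - a) * (f x ^ k - c * (f x + \<nu>) ^ k)" for x
  have D: "D x \<ge> 0" "k > 0 \<Longrightarrow> D x = 0 \<Longrightarrow> f x = a" for x
    using shifted_power_product_nonneg[of "f x" a \<nu> k] pos[of x] a0 \<nu> by (auto simp: D_def c_def)
  \<comment> \<open>Writing \<open>f x - a\<close> as \<open>(f x + \<nu>) - (\<nu> + a)\<close> in
    the second product leaves only moments of \<open>f\<close> and of
    \<open>f + \<nu>\<close>.\<close>
  have Deq: "D = (\<lambda>x. f x ^ Suc k - a * f x ^ k - c * ((f x + \<nu>) ^ Suc k - (\<nu> + a) * (f x + \<nu>) ^ k))"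
    by (auto simp: D_def algebra_simps)
  have intD: "integrable M D" unfolding Deq
    by (intro Bochner_Integration.integrable_diff integrable_mult_right int0 int\<nu>)
  have "(\<integral>x. D x \<partial>M) = H (Suc k) - a * H k - c * (G (Suc k) - (\<nu> + a) * G k)"
    unfolding Deq G_def H_def using int0 int\<nu>
    by (simp del: power_Suc add: Bochner_Integration.integral_diff integrable_mult_right Bochner_Integration.integrable_diff)
  also have "G (Suc k) - (\<nu> + a) * G k = 0"
    using G0[of k] by (simp add: a_def)
  finally have ID: "(\<integral>x. D x \<partial>M) = H (Suc k) - a * H k" by simp
  have "(\<integral>x. D x \<partial>M) \<ge> 0" using D by simp
  then have "a \<le> H (Suc k) / H k" using ID H0[of k] by (simp add: field_simps)
  then show ?ineq unfolding G_def[symmetric] H_def[symmetric] by (simp add: a_def)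
  assume k: "k > 0" and eq: "(\<integral>x. (f x + \<nu>) ^ Suc k \<partial>M) / (\<integral>x. (f x + \<nu>) ^ k \<partial>M)
      = (\<integral>x. f x ^ Suc k \<partial>M) / (\<integral>x. f x ^ k \<partial>M) + \<nu>"
  then have "a = H (Suc k) / H k" by (simp add: a_def G_def H_def)
  then have "(\<integral>x. D x \<partial>M) = 0" using ID H0[of k] by simp
  then have "AE x in M. D x = 0"
    using integral_nonneg_eq_0_iff_AE[OF intD] D by auto
  then have "AE x in M. f x = a" using D(2)[OF k] by auto
  then show "\<exists>a. AE x in M. f x = a" by blast
qed

section \<open>Rigidity and the case of balls\<close>

text \<open>By continuity, one exceptional direction would produce a nonempty open set of
  exceptional points in the ball, which is not negligible.\<close>

lemma AE_comp_sgn_const: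
  fixes f :: "'a::euclidean_space \<Rightarrow> real"
  assumes f: "continuous_on (sphere 0 1) f"
    and ae: "AE x in unit_ball_measure. f (sgn x) = a" and u: "norm u = 1"
  shows "f u = a"
proof (rule ccontr)
  assume ne: "f u \<noteq> a"
  define U where "U = (ball 0 1 - {0}) \<inter> (\<lambda>x. f (sgn x)) -` (- {a})"
  have "open U" unfolding U_def
    by (rule continuous_open_preimage) (auto intro: continuous_on_subset[OF continuous_on_comp_sgn[OF f]])
  \<comment> \<open>Halving \<open>u\<close> moves it from the boundary into the open ball without
    changing its direction.\<close>
  moreover have "(1/2) *\<^sub>R u \<in> U" using u ne by (auto simp: U_def sgn_scaleR sgn_div_norm)
  ultimately have "\<not> negligible U" using open_not_negligible by blast
  moreover have "AE x in lborel. x \<notin> U"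
  proof -
    have "AE x in lborel. x \<in> cball 0 1 \<longrightarrow> f (sgn x) = a"
      using ae by (simp add: AE_restrict_space_iff)
    then show ?thesis by eventually_elim (auto simp: U_def)
  qed
  then have "U \<in> null_sets lborel" using \<open>open U\<close> by (subst AE_iff_null_sets) auto
  then have "negligible U"
    by (simp add: negligible_iff_null_sets null_sets_completionI)
  ultimately show False by blast
qed

text \<open>The radial function is the constant \<open>R\<close>, so each value is the volume of the
  unit ball times a power of \<open>R\<close>, and the two exponents differ by one.\<close>

lemma dual_quermass_ratio_cball:
  assumes "R > 0" "i < DIM('a::euclidean_space)"
  shows "dual_quermass i (cball (0::'a) R) / dual_quermass (i + 1) (cball (0::'a) R) = R"
proof -
  define V where "V = measure unit_ball_measure (space (unit_ball_measure :: 'a measure))"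
  have "V \<noteq> 0"
    using emeasure_unit_ball_measure_pos[where 'a='a]
      finite_measure.emeasure_eq_measure[OF finite_measure_unit_ball[where 'a='a]]
    by (auto simp: V_def)
  have "dual_quermass j (cball (0::'a) R) = V * R ^ (DIM('a) - j)" if "j \<le> DIM('a)" for j
    using dual_quermass_radial_region[of "\<lambda>_::'a. R" j] that assms
    by (simp add: cball_eq_radial_region V_def)
  moreover have "DIM('a) - i = Suc (DIM('a) - (i + 1))" using assms by simp
  ultimately show ?thesis using assms \<open>V \<noteq> 0\<close> by simp
qed

section \<open>The ratio inequality for star bodies and its equality case\<close>

theorem theorem5p2:
  fixes K :: "(real ^ 'n) set" and i :: nat and r :: real
  assumes "star_body K" and "i \<le> CARD('n) - 1" and "r > 0"
  shows
    "(\<forall>t\<in>{0<..<1}.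
        dual_quermass i (radial_sum ((*\<^sub>R) (1 - t) ` K) ((*\<^sub>R) (t * r) ` cball 0 1)) /
        dual_quermass (i + 1) (radial_sum ((*\<^sub>R) (1 - t) ` K) ((*\<^sub>R) (t * r) ` cball 0 1))
        \<le> (1 - t) * (dual_quermass i K / dual_quermass (i + 1) K) +
          t * (dual_quermass i ((*\<^sub>R) r ` cball (0 :: real ^ 'n) 1) /
               dual_quermass (i + 1) ((*\<^sub>R) r ` cball (0 :: real ^ 'n) 1))) \<and>
     (i < CARD('n) - 1 \<longrightarrow>
       ((\<exists>t\<in>{0<..<1}.
          dual_quermass i (radial_sum ((*\<^sub>R) (1 - t) ` K) ((*\<^sub>R) (t * r) ` cball 0 1)) /
          dual_quermass (i + 1) (radial_sum ((*\<^sub>R) (1 - t) ` K) ((*\<^sub>R) (t * r) ` cball 0 1))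
          = (1 - t) * (dual_quermass i K / dual_quermass (i + 1) K) +
            t * (dual_quermass i ((*\<^sub>R) r ` cball (0 :: real ^ 'n) 1) /
                 dual_quermass (i + 1) ((*\<^sub>R) r ` cball (0 :: real ^ 'n) 1)))
        \<longleftrightarrow> (\<exists>R>0. K = cball 0 R)))"
proof -
  let ?M = "unit_ball_measure :: (real ^ 'n) measure"
  interpret finite_measure ?M by (rule finite_measure_unit_ball)
  obtain f where f: "continuous_on (sphere 0 1) f" and pos: "\<And>u. f u > 0" and K: "K = radial_region f"
    using star_body_radial_region[OF assms(1)] by blast
  obtain b where b: "\<And>x. f (sgn x) \<le> b" using bounded_comp_sgn[OF f] by blast
  have i: "i < CARD('n)" using assms(2) zero_less_card_finite[where 'a='n] by linarith
  \<comment> \<open>The exponent in the denominator; the numerator has \<open>Suc k\<close>. For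
    \<open>i = CARD('n) - 1\<close> it is 0 and the two sides always agree, so the equality case
    requires \<open>k > 0\<close>.\<close>
  define k where "k = CARD('n) - (i + 1)"
  have k: "CARD('n) - i = Suc k" using i by (simp add: k_def)
  define L where "L t = dual_quermass i (radial_sum ((*\<^sub>R) (1 - t) ` K) ((*\<^sub>R) (t * r) ` cball 0 1)) /
        dual_quermass (i + 1) (radial_sum ((*\<^sub>R) (1 - t) ` K) ((*\<^sub>R) (t * r) ` cball 0 1))" for t
  define Q where "Q = dual_quermass i K / dual_quermass (i + 1) K"
  have rB: "dual_quermass i ((*\<^sub>R) r ` cball (0 :: real ^ 'n) 1) /
               dual_quermass (i + 1) ((*\<^sub>R) r ` cball (0 :: real ^ 'n) 1) = r"
    using dual_quermass_ratio_cball[of r i, where 'a="real ^ 'n"] assms(3) i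
    by (simp add: scaleR_cball_0)
  have ratio: "dual_quermass i (radial_region g) / dual_quermass (i + 1) (radial_region g) =
      (\<integral>x. g (sgn x) ^ Suc k \<partial>?M) / (\<integral>x. g (sgn x) ^ k \<partial>?M)"
    if "continuous_on (sphere 0 1) g" "\<And>u. g u > 0" for g
    using dual_quermass_radial_region[OF that, of i] dual_quermass_radial_region[OF that, of "i + 1"] i k
    by (simp add: k_def del: power_Suc)
  \<comment> \<open>Stated for any positive \<open>g\<close>, because the equality case also applies
    it to the constant radial function of a ball.\<close>
  have comb: "radial_sum ((*\<^sub>R) (1 - t) ` radial_region g) ((*\<^sub>R) (t * r) ` cball 0 1)
      = radial_region (\<lambda>u. (1 - t) * g u + t * r)"
    if "t \<in> {0<..<1}" "\<And>u. g u > 0" for t and g :: "real ^ 'n \<Rightarrow> real"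
    using that assms(3) radial_sum_radial_region[of "\<lambda>u. (1 - t) * g u" "\<lambda>_. t * r"]
    by (simp add: scaleR_radial_region scaleR_cball_0 flip: cball_eq_radial_region)
  have Lt: "L t = (\<integral>x. ((1 - t) * f (sgn x) + t * r) ^ Suc k \<partial>?M) / (\<integral>x. ((1 - t) * f (sgn x) + t * r) ^ k \<partial>?M)"
    if t: "t \<in> {0<..<1}" for t
  proof -
    have "continuous_on (sphere 0 1) (\<lambda>u. (1 - t) * f u + t * r)" by (intro continuous_intros f)
    moreover have "(1 - t) * f u + t * r > 0" for u
      using t pos[of u] assms(3) by (intro add_pos_pos mult_pos_pos) auto
    ultimately show ?thesis unfolding L_def K comb[of _ f, OF t pos] by (rule ratio)
  qed
  \<comment> \<open>Dilation by \<open>1 - t\<close> contributes one more factor to the numerator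
    than to the denominator.\<close>
  have Qt: "(\<integral>x. ((1 - t) * f (sgn x)) ^ Suc k \<partial>?M) / (\<integral>x. ((1 - t) * f (sgn x)) ^ k \<partial>?M) = (1 - t) * Q"
    if "t \<in> {0<..<1}" for t
    using that unfolding Q_def K ratio[OF f pos] power_mult_distrib by simp
  \<comment> \<open>The hypotheses of \<open>moment_ratio_shift\<close> for the function
    \<open>(1 - t) * f (sgn x)\<close> and the shift \<open>t * r\<close>.\<close>
  have shift:
    "f' \<in> borel_measurable ?M" "\<And>x. f' x > 0" "\<And>x. f' x \<le> (1 - t) * b" "t * r > 0"
    if "t \<in> {0<..<1}" "f' = (\<lambda>x. (1 - t) * f (sgn x))" for t f'
    using that pos b assms(3) borel_measurable_unit_ball[OF borel_measurable_comp_sgn[OF f]]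
    by auto
  have ineq: "L t \<le> (1 - t) * Q + t * r" if t: "t \<in> {0<..<1}" for t
    using moment_ratio_shift(1)[OF shift[OF t refl] emeasure_unit_ball_measure_pos, of k]
    unfolding Lt[OF t] Qt[OF t] .
  have eqD: "\<exists>R>0. K = cball 0 R" if t: "t \<in> {0<..<1}" and eq: "L t = (1 - t) * Q + t * r" and "k > 0" for t
  proof -
    from eq have "\<exists>a. AE x in ?M. (1 - t) * f (sgn x) = a"
      using moment_ratio_shift(2)[OF shift[OF t refl] emeasure_unit_ball_measure_pos \<open>k > 0\<close>]
      unfolding Lt[OF t] Qt[OF t] by blast
    then obtain a where "AE x in ?M. (1 - t) * f (sgn x) = a" by blast
    then have "AE x in ?M. f (sgn x) = a / (1 - t)"
      by eventually_elim (use t in \<open>auto simp: field_simps\<close>)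
    \<comment> \<open>Continuity turns the almost-everywhere identity into one on the whole
      sphere.\<close>
    then have c: "f u = a / (1 - t)" if "norm u = 1" for u
      using AE_comp_sgn_const[OF f] that by blast
    obtain u :: "real ^ 'n" where "norm u = 1" using vector_choose_size[of 1] by auto
    then have R: "a / (1 - t) > 0" using c pos by metis
    \<comment> \<open>The origin is treated apart, since \<open>f 0\<close> is not tied to the
      constant value on the sphere.\<close>
    have "x \<in> K \<longleftrightarrow> x \<in> cball 0 (a / (1 - t))" for x
      using c[of "sgn x"] R less_imp_le[OF pos[of 0]]
      by (cases "x = 0") (auto simp: K radial_region_def norm_sgn)
    then show ?thesis using R by blast
  qed
  \<comment> \<open>The choice \<open>1/2\<close> is arbitrary: for a ball of radius
    \<open>R\<close> both sides equal \<open>(1 - t) * R + t * r\<close> for every \<open>t\<close>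
    in the interval.\<close>
  have eqI: "L (1/2) = (1 - 1/2) * Q + (1/2) * r" if "R > 0" "K = cball 0 R" for R
  proof -
    have t: "1/2 \<in> {0<..<1::real}" by simp
    have "radial_sum ((*\<^sub>R) (1 - 1/2) ` K) ((*\<^sub>R) (1/2 * r) ` cball 0 1) = cball 0 ((1 - 1/2) * R + 1/2 * r)"
      unfolding that(2) cball_eq_radial_region[of R]
      using comb[OF t, of "\<lambda>_. R"] that(1) by (simp add: cball_eq_radial_region)
    then have "L (1/2) = (1 - 1/2) * R + 1/2 * r"
      unfolding L_def using that(1) assms(3) i by (simp only:, subst dual_quermass_ratio_cball) auto
    moreover have "Q = R"
      unfolding Q_def that(2) using that(1) i by (subst dual_quermass_ratio_cball) auto
    ultimately show ?thesis by simp
  qed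
  have "(\<exists>t\<in>{0<..<1}. L t = (1 - t) * Q + t * r) \<longleftrightarrow> (\<exists>R>0. K = cball 0 R)" if "i < CARD('n) - 1"
  proof
    have "k > 0" using that by (simp add: k_def)
    then show "\<exists>t\<in>{0<..<1}. L t = (1 - t) * Q + t * r \<Longrightarrow> \<exists>R>0. K = cball 0 R"
      using eqD by blast
    show "\<exists>R>0. K = cball 0 R \<Longrightarrow> \<exists>t\<in>{0<..<1}. L t = (1 - t) * Q + t * r"
      using eqI by (intro bexI[of _ "1/2"]) auto
  qed
  then show ?thesis using ineq unfolding rB L_def[symmetric] Q_def[symmetric] by blast
qed

end
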